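(* Let $R$ be a ring and let $s,t\in C(R)\cap U(R)$. Then $$\Delta(H_{(s,t)}(R))=\left\{\begin{bmatrix}a&0&0\\c&d&e\\0&0&f\end{bmatrix}\in H_{(s,t)}(R)\ \middle|\ a,d,f\in\Delta(R)\right\}.$$
   Context: All rings are associative and unital; $U(S)$ is the group of units and $C(S)$ the center of a ring $S$. $\Delta(S)=\{r\in S \mid r+u\in U(S)\text{ for all }u\in U(S)\}$. For $s,t\in C(R)\cap U(R)$, $H_{(s,t)}(R)$ is the subring of $M_3(R)$ given by $$H_{(s,t)}(R)=\left\{\begin{bmatrix}a&0&0\\c&d&e\\0&0&f\end{bmatrix}\in M_3(R)\ \middle|\ a,c,d,e,f\in R,\ a-d=sc,\ d-f=te\right\}.$$ *)

theory Defs
  imports "HOL-Algebra.Subrings" "Jordan_Normal_Form.Matrix"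
begin

definition ring_center :: "('a, 'm) ring_scheme \<Rightarrow> 'a set" where
  "ring_center S = {z \<in> carrier S. \<forall>x \<in> carrier S. z \<otimes>\<^bsub>S\<^esub> x = x \<otimes>\<^bsub>S\<^esub> z}"

definition Delta :: "('a, 'm) ring_scheme \<Rightarrow> 'a set" where
  "Delta S = {r \<in> carrier S. \<forall>u \<in> Units S. r \<oplus>\<^bsub>S\<^esub> u \<in> Units S}"

text \<open>The full matrix ring over a ring given by a carrier set. The operations that
  \<^theory>\<open>Jordan_Normal_Form.Matrix\<close> provides on its matrix type are tied to type-class rings,
  so only the type itself is reused here.\<close>

definition mat_ring :: "nat \<Rightarrow> ('a, 'm) ring_scheme \<Rightarrow> 'a mat ring" where
  "mat_ring n R = \<lparr>
     carrier = {A \<in> carrier_mat n n. elements_mat A \<subseteq> carrier R},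
     monoid.mult = (\<lambda>A B. mat n n (\<lambda>(i, j). \<Oplus>\<^bsub>R\<^esub>k\<in>{..<n}. A $$ (i, k) \<otimes>\<^bsub>R\<^esub> B $$ (k, j))),
     one = mat n n (\<lambda>(i, j). if i = j then \<one>\<^bsub>R\<^esub> else \<zero>\<^bsub>R\<^esub>),
     zero = mat n n (\<lambda>(i, j). \<zero>\<^bsub>R\<^esub>),
     add = (\<lambda>A B. mat n n (\<lambda>(i, j). A $$ (i, j) \<oplus>\<^bsub>R\<^esub> B $$ (i, j)))\<rparr>"

definition H_mat :: "('a, 'm) ring_scheme \<Rightarrow> 'a \<Rightarrow> 'a \<Rightarrow> 'a \<Rightarrow> 'a \<Rightarrow> 'a \<Rightarrow> 'a mat" where
  "H_mat R a c d e f = mat_of_rows_list 3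
     [[a, \<zero>\<^bsub>R\<^esub>, \<zero>\<^bsub>R\<^esub>],
      [c, d, e],
      [\<zero>\<^bsub>R\<^esub>, \<zero>\<^bsub>R\<^esub>, f]]"

definition H_set :: "('a, 'm) ring_scheme \<Rightarrow> 'a \<Rightarrow> 'a \<Rightarrow> 'a mat set" where
  "H_set R s t = {H_mat R a c d e f | a c d e f.
     a \<in> carrier R \<and> c \<in> carrier R \<and> d \<in> carrier R \<and> e \<in> carrier R \<and> f \<in> carrier R \<and>
     a \<ominus>\<^bsub>R\<^esub> d = s \<otimes>\<^bsub>R\<^esub> c \<and> d \<ominus>\<^bsub>R\<^esub> f = t \<otimes>\<^bsub>R\<^esub> e}"

definition H_ring :: "('a, 'm) ring_scheme \<Rightarrow> 'a \<Rightarrow> 'a \<Rightarrow> 'a mat ring" where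
  "H_ring R s t = (mat_ring 3 R)\<lparr>carrier := H_set R s t\<rparr>"


lemma mat_ring_carrier_iff:
  "A \<in> carrier (mat_ring n R) \<longleftrightarrow>
     A \<in> carrier_mat n n \<and> (\<forall>i<n. \<forall>j<n. A $$ (i, j) \<in> carrier R)"
  unfolding mat_ring_def by (auto dest!: elements_matD)

lemma (in ring) mat_ring_is_ring: "ring (mat_ring n R)"
proof (rule ringI)
  show "abelian_group (mat_ring n R)"
  proof (rule abelian_groupI)
    fix A assume A: "A \<in> carrier (mat_ring n R)"
    show "\<exists>B \<in> carrier (mat_ring n R). B \<oplus>\<^bsub>mat_ring n R\<^esub> A = \<zero>\<^bsub>mat_ring n R\<^esub>"
      by (rule bexI[of _ "mat n n (\<lambda>(i, j). \<ominus> (A $$ (i, j)))"])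
        (use A in \<open>auto simp: mat_ring_carrier_iff, auto simp: mat_ring_def l_neg\<close>)
  qed (auto simp: mat_ring_carrier_iff, auto simp: mat_ring_def a_ac)
  show "monoid (mat_ring n R)"
  proof (rule monoidI)
    fix A B C
    assume A: "A \<in> carrier (mat_ring n R)" and B: "B \<in> carrier (mat_ring n R)"
      and C: "C \<in> carrier (mat_ring n R)"
    have *: "(\<Oplus>k\<in>{..<n}. (\<Oplus>l\<in>{..<n}. A $$ (i, l) \<otimes> B $$ (l, k)) \<otimes> C $$ (k, j)) =
        (\<Oplus>l\<in>{..<n}. A $$ (i, l) \<otimes> (\<Oplus>k\<in>{..<n}. B $$ (l, k) \<otimes> C $$ (k, j)))"
      if "i < n" "j < n" for i j
    proof -
      have "(\<Oplus>k\<in>{..<n}. (\<Oplus>l\<in>{..<n}. A $$ (i, l) \<otimes> B $$ (l, k)) \<otimes> C $$ (k, j)) =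
          (\<Oplus>k\<in>{..<n}. \<Oplus>l\<in>{..<n}. A $$ (i, l) \<otimes> B $$ (l, k) \<otimes> C $$ (k, j))"
        by (intro finsum_cong' refl finsum_ldistr) (use A B C that in \<open>auto simp: mat_ring_carrier_iff\<close>)
      also have "\<dots> = (\<Oplus>l\<in>{..<n}. \<Oplus>k\<in>{..<n}. A $$ (i, l) \<otimes> B $$ (l, k) \<otimes> C $$ (k, j))"
        by (rule finsum_finsum_swap) (use A B C that in \<open>auto simp: mat_ring_carrier_iff\<close>)
      also have "\<dots> = (\<Oplus>l\<in>{..<n}. \<Oplus>k\<in>{..<n}. A $$ (i, l) \<otimes> (B $$ (l, k) \<otimes> C $$ (k, j)))"
        by (intro finsum_cong' refl) (use A B C that in \<open>auto simp: mat_ring_carrier_iff m_assoc\<close>)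
      also have "\<dots> = (\<Oplus>l\<in>{..<n}. A $$ (i, l) \<otimes> (\<Oplus>k\<in>{..<n}. B $$ (l, k) \<otimes> C $$ (k, j)))"
        by (intro finsum_cong' refl finsum_rdistr[symmetric])
          (use A B C that in \<open>auto simp: mat_ring_carrier_iff\<close>)
      finally show ?thesis .
    qed
    show "A \<otimes>\<^bsub>mat_ring n R\<^esub> B \<otimes>\<^bsub>mat_ring n R\<^esub> C =
        A \<otimes>\<^bsub>mat_ring n R\<^esub> (B \<otimes>\<^bsub>mat_ring n R\<^esub> C)"
    proof -
      have "(\<Oplus>k\<in>{..<n}. mat n n (\<lambda>(i, j). \<Oplus>k\<in>{..<n}. A $$ (i, k) \<otimes> B $$ (k, j)) $$ (i, k) \<otimes> C $$ (k, j)) =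
        (\<Oplus>k\<in>{..<n}. A $$ (i, k) \<otimes> mat n n (\<lambda>(i, j). \<Oplus>k\<in>{..<n}. B $$ (i, k) \<otimes> C $$ (k, j)) $$ (k, j))"
        if "i < n" "j < n" for i j
      proof -
        have "(\<Oplus>k\<in>{..<n}. mat n n (\<lambda>(i, j). \<Oplus>k\<in>{..<n}. A $$ (i, k) \<otimes> B $$ (k, j)) $$ (i, k) \<otimes> C $$ (k, j)) =
          (\<Oplus>k\<in>{..<n}. (\<Oplus>l\<in>{..<n}. A $$ (i, l) \<otimes> B $$ (l, k)) \<otimes> C $$ (k, j))"
          by (intro finsum_cong' refl) (use A B C that in \<open>auto simp: mat_ring_carrier_iff\<close>)
        also note *[OF that]
        also have "(\<Oplus>l\<in>{..<n}. A $$ (i, l) \<otimes> (\<Oplus>k\<in>{..<n}. B $$ (l, k) \<otimes> C $$ (k, j))) =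
          (\<Oplus>k\<in>{..<n}. A $$ (i, k) \<otimes> mat n n (\<lambda>(i, j). \<Oplus>k\<in>{..<n}. B $$ (i, k) \<otimes> C $$ (k, j)) $$ (k, j))"
          by (intro finsum_cong' refl) (use A B C that in \<open>auto simp: mat_ring_carrier_iff\<close>)
        finally show ?thesis .
      qed
      then show ?thesis by (auto simp: mat_ring_def)
    qed
  next
    fix A assume A: "A \<in> carrier (mat_ring n R)"
    have "(\<Oplus>k\<in>{..<n}. mat n n (\<lambda>(i, j). if i = j then \<one> else \<zero>) $$ (i, k) \<otimes> A $$ (k, j)) = A $$ (i, j)"
      if "i < n" "j < n" for i j
    proof -
      have "(\<Oplus>k\<in>{..<n}. mat n n (\<lambda>(i, j). if i = j then \<one> else \<zero>) $$ (i, k) \<otimes> A $$ (k, j)) =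
          (\<Oplus>k\<in>{..<n}. if i = k then A $$ (k, j) else \<zero>)"
        by (intro finsum_cong' refl) (use A that in \<open>auto simp: mat_ring_carrier_iff\<close>)
      also have "\<dots> = A $$ (i, j)"
        by (rule finsum_singleton) (use A that in \<open>auto simp: mat_ring_carrier_iff\<close>)
      finally show ?thesis .
    qed
    then show "\<one>\<^bsub>mat_ring n R\<^esub> \<otimes>\<^bsub>mat_ring n R\<^esub> A = A"
      using A by (auto simp: mat_ring_def)
    have "(\<Oplus>k\<in>{..<n}. A $$ (i, k) \<otimes> mat n n (\<lambda>(i, j). if i = j then \<one> else \<zero>) $$ (k, j)) = A $$ (i, j)"
      if "i < n" "j < n" for i j
    proof -
      have "(\<Oplus>k\<in>{..<n}. A $$ (i, k) \<otimes> mat n n (\<lambda>(i, j). if i = j then \<one> else \<zero>) $$ (k, j)) =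
          (\<Oplus>k\<in>{..<n}. if j = k then A $$ (i, k) else \<zero>)"
        by (intro finsum_cong' refl) (use A that in \<open>auto simp: mat_ring_carrier_iff\<close>)
      also have "\<dots> = A $$ (i, j)"
        by (rule finsum_singleton) (use A that in \<open>auto simp: mat_ring_carrier_iff\<close>)
      finally show ?thesis .
    qed
    then show "A \<otimes>\<^bsub>mat_ring n R\<^esub> \<one>\<^bsub>mat_ring n R\<^esub> = A"
      using A by (auto simp: mat_ring_def)
  qed (auto simp: mat_ring_carrier_iff, auto simp: mat_ring_def mat_ring_carrier_iff intro!: finsum_closed)
next
  fix A B C
  assume A: "A \<in> carrier (mat_ring n R)" and B: "B \<in> carrier (mat_ring n R)"
    and C: "C \<in> carrier (mat_ring n R)"
  have "(\<Oplus>k\<in>{..<n}. mat n n (\<lambda>(i, j). A $$ (i, j) \<oplus> B $$ (i, j)) $$ (i, k) \<otimes> C $$ (k, j)) =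
      (\<Oplus>k\<in>{..<n}. A $$ (i, k) \<otimes> C $$ (k, j)) \<oplus> (\<Oplus>k\<in>{..<n}. B $$ (i, k) \<otimes> C $$ (k, j))"
    if "i < n" "j < n" for i j
  proof -
    have "(\<Oplus>k\<in>{..<n}. mat n n (\<lambda>(i, j). A $$ (i, j) \<oplus> B $$ (i, j)) $$ (i, k) \<otimes> C $$ (k, j)) =
        (\<Oplus>k\<in>{..<n}. A $$ (i, k) \<otimes> C $$ (k, j) \<oplus> B $$ (i, k) \<otimes> C $$ (k, j))"
      by (intro finsum_cong' refl) (use A B C that in \<open>auto simp: mat_ring_carrier_iff l_distr\<close>)
    also have "\<dots> = (\<Oplus>k\<in>{..<n}. A $$ (i, k) \<otimes> C $$ (k, j)) \<oplus> (\<Oplus>k\<in>{..<n}. B $$ (i, k) \<otimes> C $$ (k, j))"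
      by (rule finsum_addf) (use A B C that in \<open>auto simp: mat_ring_carrier_iff\<close>)
    finally show ?thesis .
  qed
  then show "(A \<oplus>\<^bsub>mat_ring n R\<^esub> B) \<otimes>\<^bsub>mat_ring n R\<^esub> C =
      A \<otimes>\<^bsub>mat_ring n R\<^esub> C \<oplus>\<^bsub>mat_ring n R\<^esub> B \<otimes>\<^bsub>mat_ring n R\<^esub> C"
    by (auto simp: mat_ring_def)
  have "(\<Oplus>k\<in>{..<n}. C $$ (i, k) \<otimes> mat n n (\<lambda>(i, j). A $$ (i, j) \<oplus> B $$ (i, j)) $$ (k, j)) =
      (\<Oplus>k\<in>{..<n}. C $$ (i, k) \<otimes> A $$ (k, j)) \<oplus> (\<Oplus>k\<in>{..<n}. C $$ (i, k) \<otimes> B $$ (k, j))"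
    if "i < n" "j < n" for i j
  proof -
    have "(\<Oplus>k\<in>{..<n}. C $$ (i, k) \<otimes> mat n n (\<lambda>(i, j). A $$ (i, j) \<oplus> B $$ (i, j)) $$ (k, j)) =
        (\<Oplus>k\<in>{..<n}. C $$ (i, k) \<otimes> A $$ (k, j) \<oplus> C $$ (i, k) \<otimes> B $$ (k, j))"
      by (intro finsum_cong' refl) (use A B C that in \<open>auto simp: mat_ring_carrier_iff r_distr\<close>)
    also have "\<dots> = (\<Oplus>k\<in>{..<n}. C $$ (i, k) \<otimes> A $$ (k, j)) \<oplus> (\<Oplus>k\<in>{..<n}. C $$ (i, k) \<otimes> B $$ (k, j))"
      by (rule finsum_addf) (use A B C that in \<open>auto simp: mat_ring_carrier_iff\<close>)
    finally show ?thesis .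
  qed
  then show "C \<otimes>\<^bsub>mat_ring n R\<^esub> (A \<oplus>\<^bsub>mat_ring n R\<^esub> B) =
      C \<otimes>\<^bsub>mat_ring n R\<^esub> A \<oplus>\<^bsub>mat_ring n R\<^esub> C \<otimes>\<^bsub>mat_ring n R\<^esub> B"
    by (auto simp: mat_ring_def)
qed

lemma less_3_iff: "i < (3::nat) \<longleftrightarrow> i = 0 \<or> i = 1 \<or> i = 2"
  by auto

lemma H_mat_carrier [simp]: "H_mat R a c d e f \<in> carrier_mat 3 3"
  unfolding H_mat_def mat_of_rows_list_def by (rule carrier_matI) simp_all

lemma H_mat_index [simp]:
  "H_mat R a c d e f $$ (0, 0) = a" "H_mat R a c d e f $$ (0, Suc 0) = \<zero>\<^bsub>R\<^esub>"
  "H_mat R a c d e f $$ (0, 2) = \<zero>\<^bsub>R\<^esub>" "H_mat R a c d e f $$ (Suc 0, 0) = c"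
  "H_mat R a c d e f $$ (Suc 0, Suc 0) = d" "H_mat R a c d e f $$ (Suc 0, 2) = e"
  "H_mat R a c d e f $$ (2, 0) = \<zero>\<^bsub>R\<^esub>" "H_mat R a c d e f $$ (2, Suc 0) = \<zero>\<^bsub>R\<^esub>"
  "H_mat R a c d e f $$ (2, 2) = f"
  by (simp_all add: H_mat_def mat_of_rows_list_def)

lemma (in ring) H_set_subring:
  assumes s: "s \<in> ring_center R" and t: "t \<in> ring_center R"
  shows "subring (H_set R s t) (mat_ring 3 R)"
proof -
  interpret M: ring "mat_ring 3 R" by (rule mat_ring_is_ring)
  have st [simp]: "s \<in> carrier R" "t \<in> carrier R"
    using s t by (auto simp: ring_center_def)
  have eqI: "A = B" if "A \<in> carrier_mat 3 3" "B \<in> carrier_mat 3 3"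
    "\<And>i j. i < 3 \<Longrightarrow> j < 3 \<Longrightarrow> A $$ (i, j) = B $$ (i, j)" for A B :: "'a mat"
    using that by (intro eq_matI) auto
  have set3: "{..<3::nat} = insert 0 (insert 1 {2})" by auto
  have one_eq: "\<one>\<^bsub>mat_ring 3 R\<^esub> = H_mat R \<one> \<zero> \<one> \<zero> \<one>"
    by (rule eqI) (auto simp: mat_ring_def less_3_iff)
  have add_eq: "H_mat R a c d e f \<oplus>\<^bsub>mat_ring 3 R\<^esub> H_mat R a' c' d' e' f' =
      H_mat R (a \<oplus> a') (c \<oplus> c') (d \<oplus> d') (e \<oplus> e') (f \<oplus> f')" for a c d e f a' c' d' e' f'
    by (rule eqI) (auto simp: mat_ring_def less_3_iff)
  have mult_eq: "H_mat R a c d e f \<otimes>\<^bsub>mat_ring 3 R\<^esub> H_mat R a' c' d' e' f' =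
      H_mat R (a \<otimes> a') (c \<otimes> a' \<oplus> d \<otimes> c') (d \<otimes> d') (d \<otimes> e' \<oplus> e \<otimes> f') (f \<otimes> f')"
    if [simp]: "a \<in> carrier R" "c \<in> carrier R" "d \<in> carrier R" "e \<in> carrier R" "f \<in> carrier R"
      "a' \<in> carrier R" "c' \<in> carrier R" "d' \<in> carrier R" "e' \<in> carrier R" "f' \<in> carrier R"
    for a c d e f a' c' d' e' f'
    by (rule eqI) (auto simp: mat_ring_def less_3_iff set3)
  have neg_eq: "\<ominus>\<^bsub>mat_ring 3 R\<^esub> H_mat R a c d e f = H_mat R (\<ominus> a) (\<ominus> c) (\<ominus> d) (\<ominus> e) (\<ominus> f)"
    if [simp]: "a \<in> carrier R" "c \<in> carrier R" "d \<in> carrier R" "e \<in> carrier R" "f \<in> carrier R"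
    for a c d e f
  proof (rule M.minus_equality)
    have "H_mat R (\<ominus> a) (\<ominus> c) (\<ominus> d) (\<ominus> e) (\<ominus> f) \<oplus>\<^bsub>mat_ring 3 R\<^esub> H_mat R a c d e f =
        H_mat R \<zero> \<zero> \<zero> \<zero> \<zero>"
      by (simp add: add_eq l_neg)
    also have "\<dots> = \<zero>\<^bsub>mat_ring 3 R\<^esub>"
      by (rule eqI) (auto simp: mat_ring_def less_3_iff)
    finally show "H_mat R (\<ominus> a) (\<ominus> c) (\<ominus> d) (\<ominus> e) (\<ominus> f) \<oplus>\<^bsub>mat_ring 3 R\<^esub> H_mat R a c d e f =
        \<zero>\<^bsub>mat_ring 3 R\<^esub>" .
  qed (auto simp: mat_ring_carrier_iff less_3_iff)
  have telescope: "(x \<ominus> y) \<oplus> (y \<ominus> w) = x \<ominus> w"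
    if [simp]: "x \<in> carrier R" "y \<in> carrier R" "w \<in> carrier R" for x y w
    by (simp add: minus_eq a_assoc r_neg2 r_neg1)
  have distrib: "(x \<ominus> y) \<otimes> w = x \<otimes> w \<ominus> y \<otimes> w" "w \<otimes> (x \<ominus> y) = w \<otimes> x \<ominus> w \<otimes> y"
    if [simp]: "x \<in> carrier R" "y \<in> carrier R" "w \<in> carrier R" for x y w
    by (simp_all add: minus_eq l_distr r_distr l_minus r_minus)
  have diff_mult: "a \<otimes> a' \<ominus> d \<otimes> d' = z \<otimes> (c \<otimes> a' \<oplus> d \<otimes> c')"
    if z: "z \<in> ring_center R" and [simp]: "a \<in> carrier R" "c \<in> carrier R" "d \<in> carrier R"
      "a' \<in> carrier R" "c' \<in> carrier R" "d' \<in> carrier R"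
      and eq: "a \<ominus> d = z \<otimes> c" "a' \<ominus> d' = z \<otimes> c'" for z a c d a' c' d'
  proof -
    have [simp]: "z \<in> carrier R" using z by (simp add: ring_center_def)
    have "z \<otimes> (c \<otimes> a' \<oplus> d \<otimes> c') = z \<otimes> c \<otimes> a' \<oplus> z \<otimes> d \<otimes> c'"
      by (simp add: r_distr m_assoc)
    also have "z \<otimes> d = d \<otimes> z" using z by (simp add: ring_center_def)
    also have "z \<otimes> c \<otimes> a' \<oplus> d \<otimes> z \<otimes> c' = (a \<ominus> d) \<otimes> a' \<oplus> d \<otimes> (a' \<ominus> d')"
      by (simp add: eq m_assoc)
    also have "\<dots> = a \<otimes> a' \<ominus> d \<otimes> d'" by (simp add: distrib telescope)
    finally show ?thesis by simp
  qed
  have diff_mult': "d \<otimes> d' \<ominus> f \<otimes> f' = z \<otimes> (d \<otimes> e' \<oplus> e \<otimes> f')"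
    if z: "z \<in> ring_center R" and [simp]: "d \<in> carrier R" "e \<in> carrier R" "f \<in> carrier R"
      "d' \<in> carrier R" "e' \<in> carrier R" "f' \<in> carrier R"
      and eq: "d \<ominus> f = z \<otimes> e" "d' \<ominus> f' = z \<otimes> e'" for z d e f d' e' f'
  proof -
    have [simp]: "z \<in> carrier R" using z by (simp add: ring_center_def)
    have "z \<otimes> (d \<otimes> e' \<oplus> e \<otimes> f') = z \<otimes> d \<otimes> e' \<oplus> z \<otimes> e \<otimes> f'"
      by (simp add: r_distr m_assoc)
    also have "z \<otimes> d = d \<otimes> z" using z by (simp add: ring_center_def)
    also have "d \<otimes> z \<otimes> e' \<oplus> z \<otimes> e \<otimes> f' = d \<otimes> (d' \<ominus> f') \<oplus> (d \<ominus> f) \<otimes> f'"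
      by (simp add: eq m_assoc)
    also have "\<dots> = d \<otimes> d' \<ominus> f \<otimes> f'" by (simp add: distrib telescope)
    finally show ?thesis by simp
  qed
  have diff_add: "a \<oplus> a' \<ominus> (d \<oplus> d') = z \<otimes> (c \<oplus> c')"
    if [simp]: "z \<in> carrier R" "a \<in> carrier R" "c \<in> carrier R" "d \<in> carrier R"
      "a' \<in> carrier R" "c' \<in> carrier R" "d' \<in> carrier R"
      and eq: "a \<ominus> d = z \<otimes> c" "a' \<ominus> d' = z \<otimes> c'" for z a c d a' c' d'
  proof -
    have "a \<oplus> a' \<ominus> (d \<oplus> d') = (a \<ominus> d) \<oplus> (a' \<ominus> d')"
      by (simp add: minus_eq minus_add a_ac)
    then show ?thesis by (simp add: eq r_distr)
  qed
  have diff_neg: "\<ominus> a \<ominus> \<ominus> d = z \<otimes> \<ominus> c"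
    if [simp]: "z \<in> carrier R" "a \<in> carrier R" "c \<in> carrier R" "d \<in> carrier R"
      and eq: "a \<ominus> d = z \<otimes> c" for z a c d
  proof -
    have "\<ominus> a \<ominus> \<ominus> d = \<ominus> (a \<ominus> d)"
      by (simp add: minus_eq minus_add)
    then show ?thesis by (simp add: eq r_minus)
  qed
  have in_H_set: "H_mat R a c d e f \<in> H_set R s t"
    if "a \<in> carrier R" "c \<in> carrier R" "d \<in> carrier R" "e \<in> carrier R" "f \<in> carrier R"
      "a \<ominus> d = s \<otimes> c" "d \<ominus> f = t \<otimes> e" for a c d e f
    using that unfolding H_set_def by blast
  show ?thesis
  proof (rule M.subringI)
    show "H_set R s t \<subseteq> carrier (mat_ring 3 R)"
      by (auto simp: H_set_def mat_ring_carrier_iff less_3_iff)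
    have "\<one> \<ominus> \<one> = z \<otimes> \<zero>" if "z \<in> carrier R" for z
      using that by (simp add: minus_eq r_neg)
    then show "\<one>\<^bsub>mat_ring 3 R\<^esub> \<in> H_set R s t"
      unfolding one_eq by (intro in_H_set) simp_all
    fix A assume "A \<in> H_set R s t"
    then obtain a c d e f where A: "A = H_mat R a c d e f"
      and A_in: "a \<in> carrier R" "c \<in> carrier R" "d \<in> carrier R" "e \<in> carrier R" "f \<in> carrier R"
      and A_eq: "a \<ominus> d = s \<otimes> c" "d \<ominus> f = t \<otimes> e"
      unfolding H_set_def by blast
    show "\<ominus>\<^bsub>mat_ring 3 R\<^esub> A \<in> H_set R s t"
      unfolding A neg_eq[OF A_in] by (intro in_H_set a_inv_closed diff_neg A_in A_eq st)
    fix B assume "B \<in> H_set R s t"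
    then obtain a' c' d' e' f' where B: "B = H_mat R a' c' d' e' f'"
      and B_in: "a' \<in> carrier R" "c' \<in> carrier R" "d' \<in> carrier R" "e' \<in> carrier R" "f' \<in> carrier R"
      and B_eq: "a' \<ominus> d' = s \<otimes> c'" "d' \<ominus> f' = t \<otimes> e'"
      unfolding H_set_def by blast
    show "A \<oplus>\<^bsub>mat_ring 3 R\<^esub> B \<in> H_set R s t"
      unfolding A B add_eq by (intro in_H_set a_closed diff_add A_in A_eq B_in B_eq st)
    show "A \<otimes>\<^bsub>mat_ring 3 R\<^esub> B \<in> H_set R s t"
      unfolding A B mult_eq[OF A_in B_in]
      by (intro in_H_set a_closed m_closed diff_mult[OF s] diff_mult'[OF t] A_in A_eq B_in B_eq)
  qed
qed

corollary (in ring) H_ring_is_ring: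
  assumes "s \<in> ring_center R" and "t \<in> ring_center R"
  shows "ring (H_ring R s t)"
  unfolding H_ring_def
  using mat_ring_is_ring H_set_subring[OF assms] by (rule ring.subring_is_ring)

end

theory Submission
  imports Defs "HOL-Algebra.Chinese_Remainder"
begin

text \<open>Since \<open>s\<close> and \<open>t\<close> are units, the entries \<open>c\<close> and \<open>e\<close> of a matrix in \<open>H_set R s t\<close> are
  determined by its diagonal, which may be arbitrary. As the diagonal is also multiplicative on
  these matrices, it gives a ring isomorphism from \<open>H_ring R s t\<close> onto \<open>R \<times> R \<times> R\<close>, and \<open>Delta\<close>
  commutes with isomorphisms and with direct products.\<close>

text \<open>Surjectivity writes any candidate inverse of \<open>h x\<close> as \<open>h y\<close>;
  injectivity then pulls both inverse equations back to \<open>R\<close>.\<close>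

lemma Units_ring_iso_iff:
  assumes "monoid R" and h: "h \<in> ring_iso R S" and x: "x \<in> carrier R"
  shows "h x \<in> Units S \<longleftrightarrow> x \<in> Units R"
proof -
  interpret monoid R by fact
  note mem = ring_iso_memE[OF h]
  have img: "carrier S = h ` carrier R" and inj: "inj_on h (carrier R)"
    using mem(5) by (auto simp: bij_betw_def)
  have "h x \<otimes>\<^bsub>S\<^esub> h y = \<one>\<^bsub>S\<^esub> \<longleftrightarrow> x \<otimes>\<^bsub>R\<^esub> y = \<one>\<^bsub>R\<^esub>" "h y \<otimes>\<^bsub>S\<^esub> h x = \<one>\<^bsub>S\<^esub> \<longleftrightarrow> y \<otimes>\<^bsub>R\<^esub> x = \<one>\<^bsub>R\<^esub>"
    if "y \<in> carrier R" for y
    using that x inj by (simp_all flip: mem(2,4) add: inj_on_eq_iff)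
  then show ?thesis
    using x mem(1) by (auto simp: Units_def img)
qed

text \<open>\<open>h\<close> maps \<open>Units R\<close> onto \<open>Units S\<close>, so the
  quantifier over units in \<open>Delta\<close> transfers along \<open>h\<close>.\<close>

lemma Delta_ring_iso_iff:
  assumes "ring R" and h: "h \<in> ring_iso R S" and x: "x \<in> carrier R"
  shows "h x \<in> Delta S \<longleftrightarrow> x \<in> Delta R"
proof -
  interpret ring R by fact
  note mem = ring_iso_memE[OF h]
  note units = Units_ring_iso_iff[OF monoid_axioms h]
  have img: "Units S = h ` Units R"
  proof
    show "h ` Units R \<subseteq> Units S"
      using units by auto
    show "Units S \<subseteq> h ` Units R"
    proof
      fix v assume v: "v \<in> Units S"
      then have "v \<in> h ` carrier R"
        using mem(5) by (simp add: bij_betw_def Units_def)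
      then show "v \<in> h ` Units R"
        using v units by auto
    qed
  qed
  have "h x \<oplus>\<^bsub>S\<^esub> h u \<in> Units S \<longleftrightarrow> x \<oplus>\<^bsub>R\<^esub> u \<in> Units R" if "u \<in> Units R" for u
    using x Units_closed[OF that] by (simp add: units flip: mem(3))
  then show ?thesis
    using x mem(1) by (simp add: Delta_def img)
qed

lemma Units_RDirProd: "Units (RDirProd R S) = Units R \<times> Units S"
  by (auto simp: Units_def RDirProd_def DirProd_def monoid.defs)

text \<open>Units and sums are componentwise. To isolate the condition on one factor, pair its units
  with a unit of the other factor; the identity shows that one exists.\<close>

lemma Delta_RDirProd:
  assumes "monoid R" and "monoid S"
  shows "Delta (RDirProd R S) = Delta R \<times> Delta S"
proof -
  interpret R: monoid R by fact
  interpret S: monoid S by fact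
  have "(x, y) \<oplus>\<^bsub>RDirProd R S\<^esub> (u, v) = (x \<oplus>\<^bsub>R\<^esub> u, y \<oplus>\<^bsub>S\<^esub> v)" for x y u v
    by (simp add: RDirProd_def DirProd_def monoid.defs)
  then show ?thesis
    using R.Units_one_closed S.Units_one_closed
    by (simp add: Delta_def Units_RDirProd RDirProd_carrier set_eq_iff) blast
qed

context ring
begin

lemma H_set_diagonal_bij:
  assumes s: "s \<in> Units R" and t: "t \<in> Units R"
  shows "bij_betw (\<lambda>A. (A $$ (0, 0), A $$ (Suc 0, Suc 0), A $$ (2, 2)))
    (H_set R s t) (carrier R \<times> carrier R \<times> carrier R)"
    (is "bij_betw ?diag _ _")
proof (rule bij_betw_imageI)
  show "inj_on ?diag (H_set R s t)"
    using s t by (auto simp: inj_on_def H_set_def)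
  have "(a, d, f) \<in> ?diag ` H_set R s t"
    if "a \<in> carrier R" "d \<in> carrier R" "f \<in> carrier R" for a d f
  proof
    have "u \<otimes> (inv u \<otimes> x) = x" if "u \<in> Units R" "x \<in> carrier R" for u x
      using that by (simp add: Units_closed flip: m_assoc)
    \<comment> \<open>The off-diagonal entries solve \<open>a \<ominus> d = s \<otimes> c\<close>
      and \<open>d \<ominus> f = t \<otimes> e\<close> for \<open>c\<close> and
      \<open>e\<close>.\<close>
    then show "H_mat R a (inv s \<otimes> (a \<ominus> d)) d (inv t \<otimes> (d \<ominus> f)) f \<in> H_set R s t"
      using that s t unfolding H_set_def by (intro CollectI exI conjI) (rule refl, auto)
  qed simp
  then show "?diag ` H_set R s t = carrier R \<times> carrier R \<times> carrier R"
    by (auto simp: H_set_def)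
qed

lemma H_ring_iso:
  assumes s: "s \<in> Units R" and t: "t \<in> Units R"
  shows "(\<lambda>A. (A $$ (0, 0), A $$ (Suc 0, Suc 0), A $$ (2, 2)))
    \<in> ring_iso (H_ring R s t) (RDirProd R (RDirProd R R))"
    (is "?diag \<in> _")
proof (rule ring_iso_memI)
  let ?P = "RDirProd R (RDirProd R R)"
  \<comment> \<open>Enumerating the indices lets the simplifier expand the sums in a matrix product;
    \<open>Suc 0\<close> matches the form used in \<open>H_mat_index\<close>.\<close>
  have set3: "{..<3::nat} = insert 0 (insert (Suc 0) {2})" by auto
  show "bij_betw ?diag (carrier (H_ring R s t)) (carrier ?P)"
    using H_set_diagonal_bij[OF s t] by (simp add: H_ring_def RDirProd_carrier)
  show "?diag \<one>\<^bsub>H_ring R s t\<^esub> = \<one>\<^bsub>?P\<^esub>"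
    by (simp add: H_ring_def mat_ring_def RDirProd_def DirProd_def monoid.defs)
  fix A assume A: "A \<in> carrier (H_ring R s t)"
  then show "?diag A \<in> carrier ?P"
    by (auto simp: H_ring_def H_set_def RDirProd_carrier)
  fix B assume B: "B \<in> carrier (H_ring R s t)"
  show "?diag (A \<oplus>\<^bsub>H_ring R s t\<^esub> B) = ?diag A \<oplus>\<^bsub>?P\<^esub> ?diag B"
    by (simp add: H_ring_def mat_ring_def RDirProd_def DirProd_def monoid.defs)
  \<comment> \<open>Multiplicativity rests on the zero pattern: the zeros in the first and third
    rows of \<open>A\<close> and in the middle column of \<open>B\<close> kill every mixed term in
    the diagonal of the product.\<close>
  from A obtain a c d e f where A: "A = H_mat R a c d e f" and
    [simp]: "a \<in> carrier R" "c \<in> carrier R" "d \<in> carrier R" "e \<in> carrier R" "f \<in> carrier R"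
    by (auto simp: H_ring_def H_set_def)
  from B obtain a' c' d' e' f' where B: "B = H_mat R a' c' d' e' f'" and
    [simp]: "a' \<in> carrier R" "c' \<in> carrier R" "d' \<in> carrier R" "e' \<in> carrier R" "f' \<in> carrier R"
    by (auto simp: H_ring_def H_set_def)
  show "?diag (A \<otimes>\<^bsub>H_ring R s t\<^esub> B) = ?diag A \<otimes>\<^bsub>?P\<^esub> ?diag B"
    by (simp add: A B H_ring_def mat_ring_def RDirProd_def DirProd_def monoid.defs set3)
qed

end

theorem lemma2p26:
  fixes R :: "('a, 'm) ring_scheme" and s t :: 'a
  assumes "ring R"
    and "s \<in> ring_center R \<inter> Units R"
    and "t \<in> ring_center R \<inter> Units R"
  shows "Delta (H_ring R s t) =
    {H_mat R a c d e f | a c d e f.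
       H_mat R a c d e f \<in> carrier (H_ring R s t) \<and>
       a \<in> Delta R \<and> d \<in> Delta R \<and> f \<in> Delta R}"
proof -
  interpret ring R by fact
  \<comment> \<open>Centrality of \<open>s\<close> and \<open>t\<close> enters here, their
    invertibility in \<open>iso\<close>.\<close>
  have H: "ring (H_ring R s t)"
    using assms by (auto intro: H_ring_is_ring)
  have iso: "(\<lambda>A. (A $$ (0, 0), A $$ (Suc 0, Suc 0), A $$ (2, 2)))
      \<in> ring_iso (H_ring R s t) (RDirProd R (RDirProd R R))"
    using assms by (auto intro: H_ring_iso)
  \<comment> \<open>\<open>Delta_RDirProd\<close> is applied twice; the outer application needs the
    inner product to be a monoid.\<close>
  have "Delta (RDirProd R (RDirProd R R)) = Delta R \<times> Delta R \<times> Delta R"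
    using RDirProd_ring[OF assms(1,1)]
    by (simp add: Delta_RDirProd monoid_axioms ring.axioms(2))
  then have diag: "A \<in> Delta (H_ring R s t) \<longleftrightarrow>
      A $$ (0, 0) \<in> Delta R \<and> A $$ (Suc 0, Suc 0) \<in> Delta R \<and> A $$ (2, 2) \<in> Delta R"
    if "A \<in> carrier (H_ring R s t)" for A
    using Delta_ring_iso_iff[OF H iso that] by simp
  \<comment> \<open>This inclusion has to name the entries of \<open>A\<close> before
    \<open>diag\<close> can be read off; the converse follows from \<open>diag\<close> by
    simplification.\<close>
  have "A \<in> {H_mat R a c d e f | a c d e f.
       H_mat R a c d e f \<in> carrier (H_ring R s t) \<and>
       a \<in> Delta R \<and> d \<in> Delta R \<and> f \<in> Delta R}"
    if "A \<in> Delta (H_ring R s t)" for A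
  proof -
    have "A \<in> carrier (H_ring R s t)"
      using that by (simp add: Delta_def)
    moreover from this obtain a c d e f where "A = H_mat R a c d e f"
      unfolding H_ring_def H_set_def by auto
    moreover from calculation have "a \<in> Delta R" "d \<in> Delta R" "f \<in> Delta R"
      using that diag by auto
    ultimately show ?thesis
      by blast
  qed
  then show ?thesis
    by (auto simp: diag)
qed

end
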